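(* Let $(X,d)$ be a complete metric space (with $X$ nonempty) and let $T: X\to X$ be a polynomial contraction, i.e. there exist $\lambda\in(0,1)$, a natural number $k\ge 1$ and mappings $a_i: X\times X\to[0,\infty)$, $i=0,\dots,k$, such that $$\sum_{i=0}^k a_i(Tx,Ty)\,d^i(Tx,Ty)\le \lambda\sum_{i=0}^k a_i(x,y)\,d^i(x,y)\qquad\text{for all }x,y\in X.$$ Assume that: (i) $T$ is Picard-continuous; (ii) there exist $j\in\{1,\dots,k\}$ and $A_j>0$ such that $a_j(x,y)\ge A_j$ for all $x,y\in X$. Then $T$ admits a unique fixed point $z^*\in X$. Moreover, for every $z_0\in X$, the Picard sequence $\{z_n\}\subset X$ defined by $z_{n+1}=Tz_n$ for all $n\ge 0$ converges to $z^*$.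
   Context: Here $Tx$ denotes $T(x)$ and $d^i(x,y)=(d(x,y))^i$ is the $i$-th power of the distance, with $d^0(x,y)=1$ for all $x,y\in X$ (including $x=y$), so the $i=0$ terms are $a_0(Tx,Ty)$ and $a_0(x,y)$. A mapping $T:X\to X$ on a metric space $(X,d)$ is called Picard-continuous if for all $z,w\in X$, $$\lim_{n\to\infty}d(T^nz,w)=0\ \Longrightarrow\ \lim_{n\to\infty}d(T(T^nz),Tw)=0,$$ where $T^0z=z$ and $T^{n+1}z=T(T^nz)$ for all $n\ge 0$. *)

theory Defs
  imports "HOL-Analysis.Analysis"
begin

definition picard_continuous ::
  "'a set \<Rightarrow> ('a \<Rightarrow> 'a \<Rightarrow> real) \<Rightarrow> ('a \<Rightarrow> 'a) \<Rightarrow> bool" where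
  "picard_continuous X d T \<longleftrightarrow>
     (\<forall>z\<in>X. \<forall>w\<in>X. (\<lambda>n. d ((T ^^ n) z) w) \<longlonglongrightarrow> 0 \<longrightarrow>
                   (\<lambda>n. d (T ((T ^^ n) z)) (T w)) \<longlonglongrightarrow> 0)"

(* The witnesses lam, k, a of the contraction are explicit arguments, because further
   hypotheses may constrain a.  The i = 0 terms use x ^ 0 = 1, which in HOL includes 0 ^ 0 = 1. *)
definition polynomial_contraction_wrt ::
  "'a set \<Rightarrow> ('a \<Rightarrow> 'a \<Rightarrow> real) \<Rightarrow> real \<Rightarrow> nat \<Rightarrow> (nat \<Rightarrow> 'a \<Rightarrow> 'a \<Rightarrow> real) \<Rightarrow> ('a \<Rightarrow> 'a) \<Rightarrow> bool" where
  "polynomial_contraction_wrt X d lam k a T \<longleftrightarrow>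
     0 < lam \<and> lam < 1 \<and> 1 \<le> k \<and>
     (\<forall>i\<le>k. \<forall>x\<in>X. \<forall>y\<in>X. 0 \<le> a i x y) \<and>
     (\<forall>x\<in>X. \<forall>y\<in>X.
        (\<Sum>i=0..k. a i (T x) (T y) * d (T x) (T y) ^ i)
          \<le> lam * (\<Sum>i=0..k. a i x y * d x y ^ i))"

end

theory Submission
  imports Defs
begin

text \<open>
  Write \<open>S(x, y)\<close> for the polynomial sum \<open>\<Sum>i\<le>k. a\<^sub>i(x, y) d(x, y)\<^sup>i\<close>. The hypothesis says that \<open>S\<close>
  shrinks by the factor \<open>lam\<close> when \<open>T\<close> is applied to both arguments, so \<open>S\<close> decays geometrically
  along any pair of orbits. All summands are nonnegative and one of them is at least \<open>A d\<^sup>j\<close> with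
  \<open>A > 0\<close> and \<open>j \<ge> 1\<close>, so taking \<open>j\<close>-th roots shows that the distance of the two orbits is at most
  \<open>C q\<^sup>n\<close> with \<open>q = lam\<^sup>1\<^sup>/\<^sup>j < 1\<close> (\<open>polynomial_contraction_orbits_geometric\<close>).

  Applied to the orbits of \<open>z\<close> and \<open>T z\<close>, this estimate bounds the steps of one orbit by a geometric
  sequence, so the orbit is Cauchy (\<open>MCauchy_geometric_steps\<close>) and converges; Picard continuity
  makes the limit a fixed point. Applied to the orbits of an arbitrary point and of a fixed point,
  the same estimate gives convergence to that fixed point, and hence uniqueness.
\<close>

text \<open>
  The partial sums of the geometric series bound \<open>d (s n) (s (n + p))\<close> by
  \<open>C q\<^sup>n / (1 - q)\<close>, uniformly in \<open>p\<close>.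
\<close>
lemma (in Metric_space) MCauchy_geometric_steps:
  fixes C q :: real
  assumes s: "\<And>n. s n \<in> M" and q: "0 \<le> q" "q < 1"
    and step: "\<And>n. d (s n) (s (Suc n)) \<le> C * q ^ n"
  shows "MCauchy s"
proof -
  have "0 \<le> d (s 0) (s (Suc 0))" by simp
  also have "\<dots> \<le> C" using step[of 0] by simp
  finally have C: "0 \<le> C" .
  have tele: "d (s n) (s (n + p)) \<le> C * (q ^ n - q ^ (n + p)) / (1 - q)" for n p
  proof (induction p)
    case 0
    then show ?case using s by simp
  next
    case (Suc p)
    have "d (s n) (s (n + Suc p)) \<le> d (s n) (s (n + p)) + d (s (n + p)) (s (Suc (n + p)))"
      using triangle[OF s s s] by simp
    also have "\<dots> \<le> C * (q ^ n - q ^ (n + p)) / (1 - q) + C * q ^ (n + p)"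
      using Suc.IH step by (intro add_mono)
    also have "\<dots> = C * (q ^ n - q ^ (n + Suc p)) / (1 - q)"
      using q by (simp add: field_simps)
    finally show ?case .
  qed
  have bound: "d (s n) (s m) \<le> C / (1 - q) * q ^ N" if "N \<le> n" "n \<le> m" for N n m
  proof -
    have "d (s n) (s m) \<le> C * (q ^ n - q ^ m) / (1 - q)"
      using tele[of n "m - n"] that by simp
    also have "\<dots> \<le> C * q ^ N / (1 - q)"
    proof (intro divide_right_mono mult_left_mono)
      have "q ^ n \<le> q ^ N" using q that by (simp add: power_decreasing)
      then show "q ^ n - q ^ m \<le> q ^ N" using q zero_le_power[of q m] by linarith
    qed (use q C in auto)
    finally show ?thesis by simp
  qed
  have "(\<lambda>N. C / (1 - q) * q ^ N) \<longlonglongrightarrow> C / (1 - q) * 0"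
    using q by (intro tendsto_mult tendsto_const LIMSEQ_power_zero) simp
  then have lim: "(\<lambda>N. C / (1 - q) * q ^ N) \<longlonglongrightarrow> 0" by simp
  show ?thesis
    unfolding MCauchy_def
  proof (intro conjI allI impI)
    show "range s \<subseteq> M" using s by auto
    fix \<epsilon> :: real assume "\<epsilon> > 0"
    then obtain N where N: "C / (1 - q) * q ^ N < \<epsilon>"
      using order_tendstoD(2)[OF lim] unfolding eventually_sequentially by blast
    show "\<exists>N. \<forall>n n'. N \<le> n \<longrightarrow> N \<le> n' \<longrightarrow> d (s n) (s n') < \<epsilon>"
    proof (intro exI allI impI)
      fix n n' assume "N \<le> n" "N \<le> n'"
      then have "d (s n) (s n') \<le> C / (1 - q) * q ^ N"
        using bound[of N n n'] bound[of N n' n] by (cases "n \<le> n'") (auto simp: commute)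
      then show "d (s n) (s n') < \<epsilon>" using N by linarith
    qed
  qed
qed

lemma funpow_in_invariant: "T \<in> X \<rightarrow> X \<Longrightarrow> x \<in> X \<Longrightarrow> (T ^^ n) x \<in> X"
  by (induction n) auto

text \<open>
  Since \<open>j \<ge> 1\<close>, the \<open>j\<close>-th root of \<open>A d\<^sup>j \<le> S(x, y) lam\<^sup>n\<close> turns the decay of the polynomial sum into
  decay of the distance itself. The constant depends on the pair of starting points; the rate does not.
\<close>
lemma polynomial_contraction_orbits_geometric:
  assumes d: "Metric_space X d" and T: "T \<in> X \<rightarrow> X"
    and pc: "polynomial_contraction_wrt X d lam k a T"
    and j: "j \<in> {1..k}" and A: "0 < A" "\<And>x y. x \<in> X \<Longrightarrow> y \<in> X \<Longrightarrow> A \<le> a j x y"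
    and xy: "x \<in> X" "y \<in> X"
  shows "\<exists>C. \<forall>n. d ((T ^^ n) x) ((T ^^ n) y) \<le> C * root j lam ^ n"
proof -
  interpret Metric_space X d by (rule d)
  define S where "S u v = (\<Sum>i=0..k. a i u v * d u v ^ i)" for u v
  have lam: "0 < lam" "lam < 1"
    and a: "\<And>i u v. i \<le> k \<Longrightarrow> u \<in> X \<Longrightarrow> v \<in> X \<Longrightarrow> 0 \<le> a i u v"
    and contr: "\<And>u v. u \<in> X \<Longrightarrow> v \<in> X \<Longrightarrow> S (T u) (T v) \<le> lam * S u v"
    using pc unfolding polynomial_contraction_wrt_def S_def by auto
  have mem: "(T ^^ n) x \<in> X" "(T ^^ n) y \<in> X" for n
    using funpow_in_invariant[OF T] xy by auto
  have decay: "S ((T ^^ n) x) ((T ^^ n) y) \<le> S x y * lam ^ n" for n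
  proof (induction n)
    case (Suc n)
    have "S ((T ^^ Suc n) x) ((T ^^ Suc n) y) \<le> lam * S ((T ^^ n) x) ((T ^^ n) y)"
      using contr[OF mem] by simp
    also have "\<dots> \<le> lam * (S x y * lam ^ n)"
      using lam Suc.IH by (intro mult_left_mono) auto
    finally show ?case by (simp add: mult_ac)
  qed simp
  have lower: "A * d u v ^ j \<le> S u v" if "u \<in> X" "v \<in> X" for u v
  proof -
    have "A * d u v ^ j \<le> a j u v * d u v ^ j"
      using A(2)[OF that] by (intro mult_right_mono) auto
    also have "\<dots> \<le> S u v"
      unfolding S_def using j a that
      by (intro member_le_sum[where f = "\<lambda>i. a i u v * d u v ^ i"]) auto
    finally show ?thesis .
  qed
  have "d ((T ^^ n) x) ((T ^^ n) y) \<le> root j (S x y / A) * root j lam ^ n" for n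
  proof -
    have "d ((T ^^ n) x) ((T ^^ n) y) ^ j \<le> S x y / A * lam ^ n"
      using order_trans[OF lower[OF mem] decay] A(1) by (simp add: field_simps)
    then have "root j (d ((T ^^ n) x) ((T ^^ n) y) ^ j) \<le> root j (S x y / A * lam ^ n)"
      using j by (intro real_root_le_mono) auto
    then show ?thesis
      using j by (simp add: real_root_power_cancel real_root_mult real_root_divide real_root_power)
  qed
  then show ?thesis by blast
qed

theorem theorem2p10:
  fixes X :: "'a set" and d :: "'a \<Rightarrow> 'a \<Rightarrow> real" and T :: "'a \<Rightarrow> 'a"
    and lam :: real and k :: nat and a :: "nat \<Rightarrow> 'a \<Rightarrow> 'a \<Rightarrow> real"
  assumes "Metric_space X d" and "Metric_space.mcomplete X d" and "X \<noteq> {}"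
    and "T \<in> X \<rightarrow> X"
    and "polynomial_contraction_wrt X d lam k a T"
    and "picard_continuous X d T"
    and "\<exists>j\<in>{1..k}. \<exists>A>0. \<forall>x\<in>X. \<forall>y\<in>X. A \<le> a j x y"
  shows "\<exists>z\<in>X. T z = z \<and> (\<forall>w\<in>X. T w = w \<longrightarrow> w = z) \<and>
           (\<forall>z0\<in>X. limitin (Metric_space.mtopology X d) (\<lambda>n. (T ^^ n) z0) z sequentially)"
proof -
  interpret Metric_space X d by (rule assms(1))
  obtain j A where j: "j \<in> {1..k}" and A: "A > 0" "\<And>x y. x \<in> X \<Longrightarrow> y \<in> X \<Longrightarrow> A \<le> a j x y"
    using assms(7) by blast
  define q where "q = root j lam"
  have lam: "0 < lam" "lam < 1"
    using assms(5) unfolding polynomial_contraction_wrt_def by auto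
  have q: "0 \<le> q" "q < 1"
    using lam j unfolding q_def by auto
  have geometric: "\<exists>C. \<forall>n. d ((T ^^ n) x) ((T ^^ n) y) \<le> C * q ^ n" if "x \<in> X" "y \<in> X" for x y
    unfolding q_def
    using polynomial_contraction_orbits_geometric[OF assms(1,4,5) j A that] .
  have orbit: "(T ^^ n) x \<in> X" if "x \<in> X" for n x
    using funpow_in_invariant[OF assms(4) that] .
  have asymptotic: "(\<lambda>n. d ((T ^^ n) x) ((T ^^ n) y)) \<longlonglongrightarrow> 0" if xy: "x \<in> X" "y \<in> X" for x y
  proof -
    obtain C where C: "\<And>n. d ((T ^^ n) x) ((T ^^ n) y) \<le> C * q ^ n"
      using geometric[OF xy] by blast
    have "(\<lambda>n. C * q ^ n) \<longlonglongrightarrow> C * 0"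
      using q by (intro tendsto_mult tendsto_const LIMSEQ_power_zero) simp
    then have "(\<lambda>n. C * q ^ n) \<longlonglongrightarrow> 0" by simp
    then show ?thesis
      by (rule tendsto_sandwich[OF _ _ tendsto_const, rotated -1]) (use C in auto)
  qed
  obtain x where x: "x \<in> X" using assms(3) by blast
  have Tx: "T x \<in> X" using x assms(4) by auto
  obtain C where "\<And>n. d ((T ^^ n) x) ((T ^^ n) (T x)) \<le> C * q ^ n"
    using geometric[OF x Tx] by blast
  then have "MCauchy (\<lambda>n. (T ^^ n) x)"
    using q orbit[OF x] by (intro MCauchy_geometric_steps[where q = q and C = C])
      (auto simp: funpow_swap1)
  then obtain z where z: "limitin mtopology (\<lambda>n. (T ^^ n) x) z sequentially"
    using assms(2) unfolding mcomplete_def by blast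
  then have zX: "z \<in> X" and dz: "(\<lambda>n. d ((T ^^ n) x) z) \<longlonglongrightarrow> 0"
    unfolding limitin_metric_dist_null by auto
  have TzX: "T z \<in> X" using zX assms(4) by auto
  \<comment> \<open>Picard continuity makes \<open>T z\<close> a second limit of the same orbit.\<close>
  have "(\<lambda>n. d ((T ^^ Suc n) x) (T z)) \<longlonglongrightarrow> 0"
    using assms(6) x zX dz unfolding picard_continuous_def by simp
  then have "(\<lambda>n. d ((T ^^ n) x) (T z)) \<longlonglongrightarrow> 0"
    by (rule LIMSEQ_imp_Suc)
  then have "limitin mtopology (\<lambda>n. (T ^^ n) x) (T z) sequentially"
    unfolding limitin_metric_dist_null using TzX orbit[OF x] by simp
  then have Tz: "T z = z"
    using z limitin_metric_unique by (metis trivial_limit_sequentially)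
  have stays: "(T ^^ n) w = w" if "T w = w" for w n
    using that by (induction n) auto
  show ?thesis
  proof (intro bexI[OF _ zX] conjI ballI impI)
    show "T z = z" by (rule Tz)
  next
    fix w assume w: "w \<in> X" "T w = w"
    then have "d w z = 0"
      using asymptotic[OF w(1) zX] stays Tz by (simp add: LIMSEQ_const_iff)
    then show "w = z" using w zX by simp
  next
    fix z0 assume z0: "z0 \<in> X"
    then show "limitin mtopology (\<lambda>n. (T ^^ n) z0) z sequentially"
      unfolding limitin_metric_dist_null
      using asymptotic[OF z0 zX] stays[OF Tz] zX orbit by simp
  qed
qed

end
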